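(* Fix $\varepsilon \in (0,1/100)$, an integer $n \geq 1$ and $a=(a_1,\dots,a_n) \in \mathbb{R}^n$ with $|a|=1$, satisfying $$ R_1(a) \leq \frac{1+\varepsilon}{\sqrt{2}}. $$ Then there exist two distinct indices $i_1,i_2 \in \{1,\dots,n\}$ such that $$ \frac{1-30\,\varepsilon}{\sqrt{2}} \leq |a_{i_1}|,\ |a_{i_2}| \leq \frac{1+\varepsilon}{\sqrt{2}}. $$ Also, $\sum_{i \neq i_1,i_2} a_i^2 \leq 57\,\varepsilon$ and, in particular, $|a_i| \leq \sqrt{57\,\varepsilon}$ for every $i \neq i_1,i_2$.
   Context: Here $|a|=\sqrt{a_1^2+\dots+a_n^2}$ is the Euclidean norm, and $R_1(a) = \mathbb{E}\left[\left|\sum_{i=1}^n a_i B_i\right|\right]$, where $B_1,\dots,B_n$ are independent symmetric Bernoulli variables, i.e. $\mathbb{P}(B_i=1)=\mathbb{P}(B_i=-1)=\frac12$. *)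

theory Defs
  imports "HOL-Probability.Probability"
begin

definition indep_sym_bernoulli :: "'w measure \<Rightarrow> ('i \<Rightarrow> 'w \<Rightarrow> real) \<Rightarrow> bool" where
  "indep_sym_bernoulli M B \<longleftrightarrow>
     prob_space M \<and>
     prob_space.indep_vars M (\<lambda>_. borel) B UNIV \<and>
     (\<forall>i. measure M {w \<in> space M. B i w = 1} = 1 / 2 \<and>
          measure M {w \<in> space M. B i w = - 1} = 1 / 2)"

definition R1 :: "'w measure \<Rightarrow> ('n::finite \<Rightarrow> 'w \<Rightarrow> real) \<Rightarrow> real ^ 'n \<Rightarrow> real" where
  "R1 M B a = (\<integral>w. \<bar>\<Sum>i\<in>UNIV. a $ i * B i w\<bar> \<partial>M)"

end

theory Submission
  imports Defs
begin

text \<open>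
  Haagerup's approach to the Khintchine inequality. Since
  $\int (1 - \cos (x t)) / t^2 \, dt$ is proportional to $|x|$, $R_1(a)$ is proportional to
  $\int (1 - \prod_i \cos (a_i t)) / t^2 \, dt$. By the weighted AM-GM inequality with weights
  $w_i$, the product is at most $\sum_i w_i |\cos (a_i t)|^{1 / w_i}$. Interpolating between
  consecutive even exponents keeps all integrals elementary and yields
  $R_1(a) \ge \sum_i |a_i| \, g(w_i)$, where $g(w) \ge \sqrt{w / 2}$ always and
  $g(w) = \frac34 \sqrt w$ for $w \le \frac14$.

  Let $|a_{i_1}| \ge |a_{i_2}|$ be the two largest entries and $r$ the sum of the other squares.
  With $w_i = a_i^2$, or with $w_{i_1} = \frac12$ and $w_i$ proportional to $a_i^2$ otherwise in
  case $a_{i_1}^2 > \frac12$, the excess of $\frac34$ over $1 / \sqrt 2$ on the remaining entries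
  gives $r \le 17 \varepsilon$; a third entry with $a_i^2 > \frac14$ would force
  $R_1(a) \ge \frac{23}{32}$, which is too large. The bound on $|a_{i_1}|$ is $|a_i| = |E (S B_i)| \le R_1(a)$,
  and $|a_{i_2}|$ is then bounded below through $|a| = 1$.
\<close>

section \<open>Integrals against the weight 1 / t^2\<close>

text \<open>With values in \<open>ennreal\<close>, additivity and Tonelli need no integrability.
  Negative integrands are truncated to 0, so additivity is stated for nonnegative functions only. At
  t = 0 the integrand is 0 by the convention for division, which concerns only a null set.\<close>

definition inv_square_integral :: "(real \<Rightarrow> real) \<Rightarrow> ennreal" where
  "inv_square_integral g = (\<integral>\<^sup>+t. ennreal (g t / t\<^sup>2) \<partial>lborel)"

lemma inv_square_integral_mono:
  assumes "\<And>t. f t \<le> g t"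
  shows "inv_square_integral f \<le> inv_square_integral g"
  unfolding inv_square_integral_def
  by (intro nn_integral_mono ennreal_leI divide_right_mono assms) auto

lemma inv_square_integral_cmult:
  assumes [measurable]: "g \<in> borel_measurable borel" and "0 \<le> c"
  shows "inv_square_integral (\<lambda>t. c * g t) = ennreal c * inv_square_integral g"
proof -
  have "ennreal (c * g t / t\<^sup>2) = ennreal c * ennreal (g t / t\<^sup>2)" for t
    using ennreal_mult'[OF assms(2), of "g t / t\<^sup>2"] by simp
  then show ?thesis
    unfolding inv_square_integral_def by (simp add: nn_integral_cmult)
qed

lemma inv_square_integral_sum:
  assumes [measurable]: "\<And>i. i \<in> I \<Longrightarrow> g i \<in> borel_measurable borel"
    and "\<And>i t. i \<in> I \<Longrightarrow> 0 \<le> g i t"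
  shows "inv_square_integral (\<lambda>t. \<Sum>i\<in>I. g i t) = (\<Sum>i\<in>I. inv_square_integral (g i))"
proof -
  have "inv_square_integral (\<lambda>t. \<Sum>i\<in>I. g i t) = (\<integral>\<^sup>+t. (\<Sum>i\<in>I. ennreal (g i t / t\<^sup>2)) \<partial>lborel)"
    unfolding inv_square_integral_def
    by (intro nn_integral_cong) (simp add: sum_divide_distrib assms sum_ennreal)
  also have "\<dots> = (\<Sum>i\<in>I. inv_square_integral (g i))"
    unfolding inv_square_integral_def by (rule nn_integral_sum) measurable
  finally show ?thesis .
qed

text \<open>The substitution gives a Jacobian |x| and the weight a factor 1 / x^2, so a dilation by
  x costs a net factor |x|. This homogeneity turns the integral of 1 - cos into an absolute
  value.\<close>

lemma inv_square_integral_scale: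
  assumes [measurable]: "g \<in> borel_measurable borel" and "x \<noteq> 0"
  shows "inv_square_integral (\<lambda>t. g (x * t)) = ennreal \<bar>x\<bar> * inv_square_integral g"
proof -
  have "inv_square_integral g = ennreal \<bar>x\<bar> * (\<integral>\<^sup>+t. ennreal (g (0 + x * t) / (0 + x * t)\<^sup>2) \<partial>lborel)"
    unfolding inv_square_integral_def by (rule nn_integral_real_affine) (use \<open>x \<noteq> 0\<close> in auto)
  also have "\<dots> = ennreal \<bar>x\<bar> * (ennreal (1 / x\<^sup>2) * inv_square_integral (\<lambda>t. g (x * t)))"
    by (subst inv_square_integral_cmult[symmetric]) (auto simp: inv_square_integral_def power_mult_distrib)
  finally have "ennreal \<bar>x\<bar> * inv_square_integral g
      = (ennreal \<bar>x\<bar> * (ennreal \<bar>x\<bar> * ennreal (1 / x\<^sup>2))) * inv_square_integral (\<lambda>t. g (x * t))"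
    by (simp add: mult.assoc)
  also have "ennreal \<bar>x\<bar> * (ennreal \<bar>x\<bar> * ennreal (1 / x\<^sup>2)) = 1"
    using \<open>x \<noteq> 0\<close> by (simp add: ennreal_mult[symmetric] power2_eq_square flip: abs_mult)
  finally show ?thesis by simp
qed

lemma one_minus_cos_le: "1 - cos t \<le> t\<^sup>2 / (2::real)"
proof -
  have "\<bar>sin (t/2)\<bar> \<le> \<bar>t/2\<bar>"
    by (rule abs_sin_x_le_abs_x)
  then have "(sin (t/2))\<^sup>2 \<le> (t/2)\<^sup>2"
    by (simp only: abs_le_square_iff)
  moreover have "cos t = 1 - 2 * (sin (t/2))\<^sup>2"
    using cos_double_sin[of "t/2"] by simp
  ultimately show ?thesis by (simp add: power2_eq_square)
qed

text \<open>Near 0 the integrand is at most 1/2, far away at most 2 / t^2; a multiple of 1 / (1 +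
  t^2) dominates both. Being finite and nonzero, this constant can be cancelled later without being
  computed.\<close>

lemma inv_square_integral_cos_finite: "inv_square_integral (\<lambda>t. 1 - cos t) < \<infinity>"
proof -
  have "(1 - cos t) / t\<^sup>2 \<le> 3 * inverse (1 + t\<^sup>2)" for t :: real
  proof (cases "t = 0")
    case False
    have "(1 - cos t) * (1 + t\<^sup>2) = (1 - cos t) + (1 - cos t) * t\<^sup>2"
      by (simp add: algebra_simps)
    also have "\<dots> \<le> t\<^sup>2 / 2 + 2 * t\<^sup>2"
      using cos_ge_minus_one[of t]
      by (intro add_mono one_minus_cos_le mult_right_mono) auto
    finally have *: "(1 - cos t) * (1 + t\<^sup>2) \<le> 3 * t\<^sup>2"
      using zero_le_power2[of t] by linarith
    have "t\<^sup>2 > 0" "1 + t\<^sup>2 > 0"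
      using False by (auto simp: add_pos_nonneg)
    then show ?thesis using * by (simp add: field_simps)
  qed auto
  then have "inv_square_integral (\<lambda>t. 1 - cos t) \<le> (\<integral>\<^sup>+t. ennreal (3 * inverse (1 + t\<^sup>2)) \<partial>lborel)"
    unfolding inv_square_integral_def by (intro nn_integral_mono ennreal_leI)
  also have "\<dots> < \<infinity>"
  proof -
    have "integrable lborel (\<lambda>t::real. inverse (1 + t\<^sup>2))"
      using integrable_inverse_1_plus_square by (simp add: set_integrable_def)
    then have "integrable lborel (\<lambda>t::real. 3 * inverse (1 + t\<^sup>2))"
      by simp
    then show ?thesis
      unfolding integrable_iff_bounded by (auto simp: add_nonneg_nonneg)
  qed
  finally show ?thesis .
qed

lemma inv_square_integral_cos_pos: "inv_square_integral (\<lambda>t. 1 - cos t) \<noteq> 0"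
proof
  assume "inv_square_integral (\<lambda>t. 1 - cos t) = 0"
  then have "AE t in lborel. ennreal ((1 - cos t) / t\<^sup>2) = 0"
    unfolding inv_square_integral_def by (subst (asm) nn_integral_0_iff_AE) auto
  then have ae: "AE t in lborel. cos t = (1::real) \<or> t = 0"
  proof eventually_elim
    case (elim t)
    then show ?case by simp
  qed
  have "AE t in lborel. t \<notin> {0<..<pi::real}"
    using ae
  proof eventually_elim
    case (elim t)
    then show ?case using cos_monotone_0_pi[of 0 t] by auto
  qed
  then have "{0<..<pi::real} \<in> null_sets lborel"
    by (subst AE_iff_null_sets) auto
  then show False by (simp add: null_sets_def)
qed

lemma inv_square_integral_cos: "inv_square_integral (\<lambda>t. 1 - cos (x * t)) = ennreal \<bar>x\<bar> * inv_square_integral (\<lambda>t. 1 - cos t)"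
  by (cases "x = 0") (use inv_square_integral_scale[of "\<lambda>t. 1 - cos t" x] in \<open>auto simp: inv_square_integral_def\<close>)

section \<open>Even powers of the cosine and sums of signs\<close>

text \<open>Binomial expansion of (e^(it) + e^(-it))^m. Divided by 2^m, the coefficients are the
  probabilities of a sum of m independent signs, whose characteristic function is cos^m.\<close>

lemma cos_power_eq:
  "cos t ^ m = (\<Sum>j\<le>m. (m choose j) * cos ((real m - 2 * real j) * t)) / 2 ^ m"
proof -
  have "complex_of_real (2 * cos t) ^ m = (cis t + cis (- t)) ^ m"
    by (simp add: complex_eq_iff cis.ctr)
  also have "\<dots> = (\<Sum>j\<le>m. of_nat (m choose j) * cis t ^ j * cis (- t) ^ (m - j))"
    by (rule binomial_ring)
  also have "\<dots> = (\<Sum>j\<le>m. of_nat (m choose j) * cis (- ((real m - 2 * real j) * t)))"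
    by (rule sum.cong) (simp_all add: Complex.DeMoivre cis_mult of_nat_diff algebra_simps)
  finally have "Re (complex_of_real (2 * cos t) ^ m) = Re \<dots>" by simp
  then have "(2 * cos t) ^ m = (\<Sum>j\<le>m. (m choose j) * cos ((real m - 2 * real j) * t))"
    by (simp flip: of_real_power add: Re_power_real)
  then show ?thesis by (simp add: power_mult_distrib field_simps)
qed

text \<open>The terms below the centre have a closed partial row sum, the central term vanishes, and
  the reflection of j to 2k - j copies the lower half onto the upper one.\<close>

lemma sum_choose_abs_centre:
  "(\<Sum>j\<le>2*k. ((2*k) choose j) * \<bar>real (2*k) - 2 * real j\<bar>) = 2 * real k * ((2*k) choose k)"
proof (cases "k = 0")
  case False
  then obtain l where l: "k = Suc l" by (cases k) auto
  let ?f = "\<lambda>j. ((2*k) choose j) * \<bar>real (2*k) - 2 * real j\<bar>"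
  have lower: "(\<Sum>j<k. ?f j) = real k * ((2*k) choose k)"
  proof -
    \<comment> \<open>The summand is brought into the shape required by
      \<open>gbinomial_partial_row_sum\<close>, hence the generalized binomial coefficient and the
      inclusive upper limit \<open>l\<close>, which is k - 1.\<close>
    have "(\<Sum>j<k. ?f j) = (\<Sum>j\<le>l. 2 * ((real (2*k) gchoose j) * (real (2*k) / 2 - real j)))"
      unfolding l lessThan_Suc_atMost
      by (rule sum.cong) (auto simp: binomial_gbinomial algebra_simps)
    also have "\<dots> = 2 * ((real l + 1) / 2 * (real (2*k) gchoose (l + 1)))"
      by (simp only: sum_distrib_left[symmetric] gbinomial_partial_row_sum)
    also have "l + 1 = k" using l by simp
    also have "2 * ((real l + 1) / 2 * (real (2*k) gchoose k)) = real k * (real (2*k) gchoose k)"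
      using l by (simp only:) simp
    finally show ?thesis
      by (simp only: binomial_gbinomial)
  qed
  have upper: "(\<Sum>j\<in>{k<..2*k}. ?f j) = (\<Sum>j<k. ?f j)"
  proof (rule sum.reindex_bij_witness[where i="\<lambda>j. 2*k - j" and j="\<lambda>j. 2*k - j"])
    fix j assume "j \<in> {k<..2*k}"
    then show "?f (2*k - j) = ?f j"
      using binomial_symmetric[of j "2*k"] by (auto simp: of_nat_diff)
  qed auto
  have "{..2*k} = {..<k} \<union> ({k} \<union> {k<..2*k})" by auto
  then have "(\<Sum>j\<le>2*k. ?f j) = (\<Sum>j<k. ?f j) + (?f k + (\<Sum>j\<in>{k<..2*k}. ?f j))"
    by (simp only:) (subst sum.union_disjoint, auto)+
  then show ?thesis using lower upper by simp
qed auto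

text \<open>The mean absolute value of a sum of $2k$ independent signs.\<close>
definition mean_abs :: "nat \<Rightarrow> real" where
  "mean_abs k = 2 * real k * ((2*k) choose k) / 4 ^ k"

text \<open>The function 1 - cos^(2k) is an average of functions 1 - cos (y t), where y runs through
  the values of x times a sum of 2k signs. Each contributes |y|, and the average of |y| is |x| times
  \<open>mean_abs k\<close>.\<close>

lemma inv_square_integral_cos_power:
  "inv_square_integral (\<lambda>t. 1 - cos (x * t) ^ (2*k)) = ennreal (\<bar>x\<bar> * mean_abs k) * inv_square_integral (\<lambda>t. 1 - cos t)"
proof -
  let ?y = "\<lambda>j. (real (2*k) - 2 * real j) * x"
  let ?p = "\<lambda>j. real ((2*k) choose j) / 4 ^ k"
  have total: "(\<Sum>j\<le>2*k. ?p j) = 1"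
    by (simp add: sum_divide_distrib[symmetric] of_nat_sum[symmetric] choose_row_sum
        del: of_nat_sum) (simp add: power_mult)
  have "1 - cos (x * t) ^ (2*k) = (\<Sum>j\<le>2*k. ?p j * (1 - cos (?y j * t)))" for t
  proof -
    have "cos (x * t) ^ (2*k) = (\<Sum>j\<le>2*k. ?p j * cos (?y j * t))"
      by (subst cos_power_eq) (simp add: sum_divide_distrib power_mult mult.assoc)
    then show ?thesis
      by (simp add: right_diff_distrib sum_subtractf total)
  qed
  then have "inv_square_integral (\<lambda>t. 1 - cos (x * t) ^ (2*k)) = (\<Sum>j\<le>2*k. inv_square_integral (\<lambda>t. ?p j * (1 - cos (?y j * t))))"
    by (simp only:) (rule inv_square_integral_sum, auto)
  also have "\<dots> = (\<Sum>j\<le>2*k. ennreal (?p j * \<bar>?y j\<bar>) * inv_square_integral (\<lambda>t. 1 - cos t))"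
  proof (rule sum.cong)
    fix j
    have "inv_square_integral (\<lambda>t. ?p j * (1 - cos (?y j * t))) = ennreal (?p j) * inv_square_integral (\<lambda>t. 1 - cos (?y j * t))"
      by (rule inv_square_integral_cmult) auto
    then show "inv_square_integral (\<lambda>t. ?p j * (1 - cos (?y j * t))) = ennreal (?p j * \<bar>?y j\<bar>) * inv_square_integral (\<lambda>t. 1 - cos t)"
      by (simp only: inv_square_integral_cos, subst ennreal_mult, simp_all only: mult.assoc, auto)
  qed simp
  also have "\<dots> = ennreal (\<Sum>j\<le>2*k. ?p j * \<bar>?y j\<bar>) * inv_square_integral (\<lambda>t. 1 - cos t)"
    by (simp only: sum_distrib_right[symmetric], subst sum_ennreal) auto
  also have "(\<Sum>j\<le>2*k. ?p j * \<bar>?y j\<bar>) = \<bar>x\<bar> * mean_abs k"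
  proof -
    have "(\<Sum>j\<le>2*k. ?p j * \<bar>?y j\<bar>)
        = (\<Sum>j\<le>2*k. (((2*k) choose j) * \<bar>real (2*k) - 2 * real j\<bar>) * (\<bar>x\<bar> / 4 ^ k))"
      by (rule sum.cong) (auto simp: abs_mult)
    also have "\<dots> = \<bar>x\<bar> * mean_abs k"
      by (subst sum_distrib_right[symmetric]) (simp only: sum_choose_abs_centre, simp add: mean_abs_def)
    finally show ?thesis .
  qed
  finally show ?thesis .
qed

lemma mean_abs_1: "mean_abs 1 = 1"
  by (simp add: mean_abs_def numeral_2_eq_2)

text \<open>The ratio of consecutive central binomial coefficients is 2 (2k + 1) / (k + 1). At k = 0
  the recursion fails: \<open>mean_abs 0\<close> is 0, but \<open>mean_abs 1\<close> is 1.\<close>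

lemma mean_abs_Suc:
  assumes "k > 0"
  shows "mean_abs (Suc k) = mean_abs k * (1 + 1 / (2 * real k))"
proof -
  have "Suc k * ((2 * Suc k) choose Suc k) = 2 * (2 * k + 1) * ((2 * k) choose k)"
  proof -
    have "Suc k * ((2 * Suc k) choose Suc k) = (2 * Suc k) * (Suc (2 * k) choose k)"
      using binomial_absorption[of k "2 * Suc k"] by simp
    moreover have "Suc k * (Suc (2*k) choose k) = (2*k+1) * ((2*k) choose k)"
      using binomial_absorb_comp[of "Suc (2*k)" k] by (simp add: Suc_diff_le)
    ultimately have "Suc k * (Suc k * ((2 * Suc k) choose Suc k)) = Suc k * (2 * (2 * k + 1) * ((2 * k) choose k))"
      by (metis (no_types, opaque_lifting) mult.assoc mult.left_commute)
    then show ?thesis by (simp only: mult_cancel1) simp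
  qed
  then have "real (Suc k) * ((2 * Suc k) choose Suc k) = 2 * (2 * real k + 1) * ((2 * k) choose k)"
    by (simp only: flip: of_nat_mult) (simp add: algebra_simps)
  then have "mean_abs (Suc k) = 2 * (2 * (2 * real k + 1) * ((2 * k) choose k)) / 4 ^ Suc k"
    by (simp only: mean_abs_def mult.assoc)
  then show ?thesis using assms by (simp add: mean_abs_def field_simps)
qed

text \<open>The quotient of \<open>mean_abs k\<close> and sqrt (2k) increases with k, because (1 + 1
  / (2k))^2 \<ge> 1 + 1 / k, and equals 3/4 at k = 2. At k = 1 it is only 1 / sqrt 2; the stability
  estimate lives on this gap.\<close>

lemma mean_abs_ge:
  assumes "2 \<le> k"
  shows "3 / 4 * sqrt (2 * real k) \<le> mean_abs k"
  using assms
proof (induction k rule: dec_induct)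
  case base
  have "mean_abs 2 = 3 / 2"
    using mean_abs_Suc[of 1] mean_abs_1 by (simp add: numeral_2_eq_2)
  then show ?case by (simp add: real_sqrt_eq_iff)
next
  case (step k)
  have "2 * real (Suc k) \<le> 2 * real k * (1 + 1 / (2 * real k))\<^sup>2"
    using step.hyps by (simp add: field_simps power2_eq_square)
  then have "sqrt (2 * real (Suc k)) \<le> sqrt (2 * real k * (1 + 1 / (2 * real k))\<^sup>2)"
    by (simp only: real_sqrt_le_iff)
  also have "\<dots> = sqrt (2 * real k) * (1 + 1 / (2 * real k))"
    by (simp add: real_sqrt_mult)
  finally have "3 / 4 * sqrt (2 * real (Suc k)) \<le> (3 / 4 * sqrt (2 * real k)) * (1 + 1 / (2 * real k))"
    by simp
  also have "\<dots> \<le> mean_abs k * (1 + 1 / (2 * real k))"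
    by (rule mult_right_mono) (use step in auto)
  finally show ?case using mean_abs_Suc[of k] step.hyps by simp
qed

section \<open>Decoupling a product of cosines\<close>

text \<open>Jensen's inequality for exp at the points ln (x i). A vanishing x i is split off because
  of the logarithm; the product is then 0, even for weight 0, since \<open>0 powr 0\<close> is
  0.\<close>

lemma weighted_arith_geom_mean:
  fixes w x :: "'a \<Rightarrow> real"
  assumes "finite I" and w: "\<And>i. i \<in> I \<Longrightarrow> 0 \<le> w i" "sum w I = 1"
    and x: "\<And>i. i \<in> I \<Longrightarrow> 0 \<le> x i"
  shows "(\<Prod>i\<in>I. x i powr w i) \<le> (\<Sum>i\<in>I. w i * x i)"
proof (cases "\<exists>i\<in>I. x i = 0")
  case True
  then have "(\<Prod>i\<in>I. x i powr w i) = 0"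
    using \<open>finite I\<close> by (auto intro!: prod_zero)
  then show ?thesis using w x by (simp add: sum_nonneg)
next
  case False
  then have pos: "0 < x i" if "i \<in> I" for i
    using x[OF that] that by force
  have "I \<noteq> {}" using w by auto
  have "(\<Prod>i\<in>I. x i powr w i) = exp (\<Sum>i\<in>I. w i *\<^sub>R ln (x i))"
    unfolding exp_sum[OF \<open>finite I\<close>] by (rule prod.cong) (use pos in \<open>force simp: powr_def\<close>)+
  also have "\<dots> \<le> (\<Sum>i\<in>I. w i * exp (ln (x i)))"
    by (rule convex_on_sum[OF \<open>finite I\<close> \<open>I \<noteq> {}\<close> exp_convex]) (use w in auto)
  also have "\<dots> = (\<Sum>i\<in>I. w i * x i)"
    using pos by (intro sum.cong) auto
  finally show ?thesis .
qed

lemma inv_square_integral_add: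
  assumes [measurable]: "f \<in> borel_measurable borel" "g \<in> borel_measurable borel"
    and "\<And>t. 0 \<le> f t" "\<And>t. 0 \<le> g t"
  shows "inv_square_integral (\<lambda>t. f t + g t) = inv_square_integral f + inv_square_integral g"
  unfolding inv_square_integral_def
  by (subst nn_integral_add[symmetric])
     (auto simp: add_divide_distrib assms ennreal_plus intro!: nn_integral_cong)

text \<open>With $g$ = \<open>gain\<close>, $|a| \, g(w)$ is a lower bound for the contribution of an entry $a$ used with weight $w$; on
  $[\frac14, \frac12]$ it comes from interpolating between the exponents 2 and 4.\<close>
definition gain :: "real \<Rightarrow> real" where
  "gain w = (if w \<le> 1 / 4 then 3 / 4 * sqrt w else w / 2 + 1 / 4)"

text \<open>The natural candidate for g is |cos (x t)|^(1/w). A convex combination of the two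
  neighbouring even powers lies above it, and its integral is known exactly. The bound w \<le> 1/2
  keeps the lower exponent at least 2.\<close>

lemma exists_cos_majorant:
  assumes "0 < w" "w \<le> 1 / 2"
  obtains g where "g \<in> borel_measurable borel" "\<And>t. 0 \<le> g t" "\<And>t. g t \<le> 1"
    "\<And>t. \<bar>cos (x * t)\<bar> \<le> g t powr w"
    "ennreal (\<bar>x\<bar> * gain w) * inv_square_integral (\<lambda>t. 1 - cos t) \<le> ennreal w * inv_square_integral (\<lambda>t. 1 - g t)"
proof -
  \<comment> \<open>Integer and fractional part of 1 / (2w): the exponent 1/w = 2 (k + \<theta>)
    lies between 2k and 2k + 2.\<close>
  define k where "k = nat \<lfloor>1 / (2 * w)\<rfloor>"
  define \<theta> where "\<theta> = frac (1 / (2 * w))"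
  have \<theta>: "0 \<le> \<theta>" "\<theta> < 1"
    by (simp_all add: \<theta>_def frac_lt_1)
  have "1 \<le> 1 / (2 * w)"
    using assms by (simp add: field_simps)
  then have "1 \<le> \<lfloor>1 / (2 * w)\<rfloor>"
    by (simp only: le_floor_iff of_int_1)
  then have k: "1 \<le> k" and "real k = of_int \<lfloor>1 / (2 * w)\<rfloor>"
    unfolding k_def by linarith+
  then have w: "1 / w = 2 * (real k + \<theta>)"
    by (simp add: \<theta>_def frac_def)
  define g where "g = (\<lambda>t. (1 - \<theta>) * cos (x * t) ^ (2 * k) + \<theta> * cos (x * t) ^ (2 * Suc k))"
  have g_eq: "g t = \<bar>cos (x * t)\<bar> ^ (2 * k) * ((1 - \<theta>) + \<theta> * (cos (x * t))\<^sup>2)" for t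
    unfolding g_def by (subst power_even_abs) (auto simp: algebra_simps power2_eq_square)
  have le1: "cos (x * t) ^ (2 * j) \<le> 1" for t and j :: nat
    unfolding power_mult by (rule power_le_one) (auto simp: abs_square_le_1)
  have "g \<in> borel_measurable borel"
    unfolding g_def by measurable
  moreover have "0 \<le> g t" for t
    unfolding g_eq using \<theta> by (intro mult_nonneg_nonneg add_nonneg_nonneg) auto
  moreover have "g t \<le> 1" for t
  proof -
    have "(1 - \<theta>) * cos (x * t) ^ (2 * k) \<le> (1 - \<theta>) * 1"
         "\<theta> * cos (x * t) ^ (2 * Suc k) \<le> \<theta> * 1"
      using \<theta> by (intro mult_left_mono le1; simp)+
    from add_mono[OF this] show ?thesis by (simp add: g_def)
  qed
  moreover have "\<bar>cos (x * t)\<bar> \<le> g t powr w" for t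
  proof (cases "cos (x * t) = 0")
    case False
    define c where "c = \<bar>cos (x * t)\<bar>"
    have c: "c > 0" using False by (simp add: c_def)
    \<comment> \<open>Young's inequality, c^(2 \<theta>) \<le> 1 - \<theta> + \<theta> c^2;
      multiplied by c^(2k) it compares c^(1/w) with g.\<close>
    have "1 powr (1 - \<theta>) * (c\<^sup>2) powr \<theta> \<le> (1 - \<theta>) * 1 + \<theta> * c\<^sup>2"
      by (rule Youngs_inequality_0) (use \<theta> c in auto)
    then have "c ^ (2 * k) * (c\<^sup>2) powr \<theta> \<le> g t"
      unfolding g_eq c_def by (intro mult_left_mono) auto
    also have "c ^ (2 * k) * (c\<^sup>2) powr \<theta> = c powr (1 / w)"
    proof -
      have "c ^ (2 * k) = c powr real (2 * k)" "c\<^sup>2 = c powr real 2"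
        by (rule powr_realpow[OF c, symmetric])+
      then show ?thesis
        unfolding w by (simp only: powr_powr powr_add[symmetric]) (simp add: distrib_left)
    qed
    finally have "(c powr (1 / w)) powr w \<le> g t powr w"
      using assms by (intro powr_mono2) auto
    then show ?thesis
      using assms c by (simp add: powr_powr c_def)
  qed auto
  moreover have "ennreal (\<bar>x\<bar> * gain w) * inv_square_integral (\<lambda>t. 1 - cos t) \<le> ennreal w * inv_square_integral (\<lambda>t. 1 - g t)"
  proof -
    let ?m = "(1 - \<theta>) * mean_abs k + \<theta> * mean_abs (Suc k)"
    have nonneg: "0 \<le> mean_abs j" for j
      by (simp add: mean_abs_def)
    have "inv_square_integral (\<lambda>t. 1 - g t)
        = inv_square_integral (\<lambda>t. (1 - \<theta>) * (1 - cos (x * t) ^ (2 * k)) + \<theta> * (1 - cos (x * t) ^ (2 * Suc k)))"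
      by (rule arg_cong[where f=inv_square_integral]) (auto simp: g_def algebra_simps)
    also have "\<dots> = inv_square_integral (\<lambda>t. (1 - \<theta>) * (1 - cos (x * t) ^ (2 * k)))
        + inv_square_integral (\<lambda>t. \<theta> * (1 - cos (x * t) ^ (2 * Suc k)))"
      using \<theta> le1 by (intro inv_square_integral_add) (measurable, auto simp del: power_Suc mult_Suc_right)
    also have "\<dots> = ennreal (1 - \<theta>) * inv_square_integral (\<lambda>t. 1 - cos (x * t) ^ (2 * k))
        + ennreal \<theta> * inv_square_integral (\<lambda>t. 1 - cos (x * t) ^ (2 * Suc k))"
      using \<theta> by (subst (1 2) inv_square_integral_cmult) auto
    also have "\<dots> = (ennreal (1 - \<theta>) * ennreal (\<bar>x\<bar> * mean_abs k)
        + ennreal \<theta> * ennreal (\<bar>x\<bar> * mean_abs (Suc k))) * inv_square_integral (\<lambda>t. 1 - cos t)"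
      by (simp only: inv_square_integral_cos_power distrib_right mult.assoc)
    also have "ennreal (1 - \<theta>) * ennreal (\<bar>x\<bar> * mean_abs k) + ennreal \<theta> * ennreal (\<bar>x\<bar> * mean_abs (Suc k))
        = ennreal ((1 - \<theta>) * (\<bar>x\<bar> * mean_abs k) + \<theta> * (\<bar>x\<bar> * mean_abs (Suc k)))"
      using \<theta> nonneg by (simp add: ennreal_mult)
    also have "(1 - \<theta>) * (\<bar>x\<bar> * mean_abs k) + \<theta> * (\<bar>x\<bar> * mean_abs (Suc k)) = \<bar>x\<bar> * ?m"
      by (simp add: algebra_simps)
    finally have integral_g: "inv_square_integral (\<lambda>t. 1 - g t) = ennreal (\<bar>x\<bar> * ?m) * inv_square_integral (\<lambda>t. 1 - cos t)" .
    \<comment> \<open>The recursion for \<open>mean_abs\<close> turns the interpolated mean into a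
      single product.\<close>
    have "?m = mean_abs k * (1 + \<theta> / (2 * real k))"
      using k by (simp add: mean_abs_Suc algebra_simps)
    moreover have "gain w \<le> w * (mean_abs k * (1 + \<theta> / (2 * real k)))"
    proof (cases "w \<le> 1 / 4")
      case True
      have "2 \<le> 1 / (2 * w)"
        using True assms by (simp add: field_simps)
      then have "2 \<le> k"
        unfolding k_def by linarith
      \<comment> \<open>The right side expands to 2k + 2 \<theta> + \<theta>^2 / (2k), which exceeds
        1/w by its last term.\<close>
      have "1 / w \<le> 2 * real k * (1 + \<theta> / (2 * real k))\<^sup>2"
        unfolding w using k \<theta> by (simp add: field_simps power2_eq_square)
      then have "sqrt (1 / w) \<le> sqrt (2 * real k * (1 + \<theta> / (2 * real k))\<^sup>2)"
        by (simp only: real_sqrt_le_iff)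
      also have "\<dots> = sqrt (2 * real k) * (1 + \<theta> / (2 * real k))"
        using \<theta> by (simp add: real_sqrt_mult)
      finally have "3 / 4 * sqrt (1 / w) \<le> (3 / 4 * sqrt (2 * real k)) * (1 + \<theta> / (2 * real k))"
        by simp
      also have "\<dots> \<le> mean_abs k * (1 + \<theta> / (2 * real k))"
        by (rule mult_right_mono) (use mean_abs_ge[OF \<open>2 \<le> k\<close>] \<theta> in auto)
      finally have "w * (3 / 4 * sqrt (1 / w)) \<le> w * \<dots>"
        using assms by (intro mult_left_mono) auto
      moreover have "w * sqrt (1 / w) = sqrt w"
        using assms by (simp add: real_sqrt_divide real_div_sqrt)
      ultimately show ?thesis using True by (simp add: gain_def)
    next
      case False
      have "1 / (2 * w) < 2"
        using False assms by (simp add: field_simps)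
      then have "k < 2"
        unfolding k_def by linarith
      then have "k = 1" using k by simp
      \<comment> \<open>For k = 1 one has w \<theta> = 1/2 - w; this is the source of the affine
        branch of \<open>gain\<close>.\<close>
      then have "w * (1 + \<theta> / 2) = w / 2 + 1 / 4"
        using w assms by (simp add: field_simps)
      then show ?thesis
        using False \<open>k = 1\<close> mean_abs_1 by (simp add: gain_def)
    qed
    ultimately have "\<bar>x\<bar> * gain w \<le> w * (\<bar>x\<bar> * ?m)"
      using mult_left_mono[of "gain w" "w * ?m" "\<bar>x\<bar>"] by (simp add: mult.left_commute)
    then have "ennreal (\<bar>x\<bar> * gain w) \<le> ennreal w * ennreal (\<bar>x\<bar> * ?m)"
      using assms by (simp add: ennreal_mult'[symmetric] ennreal_leI)
    then have "ennreal (\<bar>x\<bar> * gain w) * inv_square_integral (\<lambda>t. 1 - cos t)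
        \<le> ennreal w * ennreal (\<bar>x\<bar> * ?m) * inv_square_integral (\<lambda>t. 1 - cos t)"
      by (rule mult_right_mono) simp
    then show ?thesis
      by (simp only: integral_g mult.assoc)
  qed
  ultimately show ?thesis by (rule that)
qed

text \<open>As the weights sum to 1, the mean inequality bounds 1 minus the product from below by
  the sum of w i (1 - g i), so that each entry can be integrated separately.\<close>

lemma inv_square_integral_prod_cos_ge:
  fixes a w :: "'i \<Rightarrow> real"
  assumes "finite I" and w: "\<And>i. i \<in> I \<Longrightarrow> 0 < w i" "\<And>i. i \<in> I \<Longrightarrow> w i \<le> 1 / 2"
    and sum: "sum w I = 1"
  shows "ennreal (\<Sum>i\<in>I. \<bar>a i\<bar> * gain (w i)) * inv_square_integral (\<lambda>t. 1 - cos t)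
    \<le> inv_square_integral (\<lambda>t. 1 - (\<Prod>i\<in>I. cos (a i * t)))"
proof -
  let ?P = "\<lambda>i g. g \<in> borel_measurable borel \<and> (\<forall>t. 0 \<le> g t) \<and> (\<forall>t. g t \<le> 1) \<and>
    (\<forall>t. \<bar>cos (a i * t)\<bar> \<le> g t powr w i) \<and>
    ennreal (\<bar>a i\<bar> * gain (w i)) * inv_square_integral (\<lambda>t. 1 - cos t) \<le> ennreal (w i) * inv_square_integral (\<lambda>t. 1 - g t)"
  have "\<forall>i\<in>I. \<exists>g. ?P i g"
    using exists_cos_majorant w by metis
  from bchoice[OF this] obtain g where g: "\<And>i. i \<in> I \<Longrightarrow> ?P i (g i)"
    by blast
  then have [measurable]: "i \<in> I \<Longrightarrow> g i \<in> borel_measurable borel" for i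
    by blast
  have "0 \<le> gain (w i)" if "i \<in> I" for i
    using w[OF that] by (auto simp: gain_def)
  then have "ennreal (\<Sum>i\<in>I. \<bar>a i\<bar> * gain (w i)) * inv_square_integral (\<lambda>t. 1 - cos t)
      = (\<Sum>i\<in>I. ennreal (\<bar>a i\<bar> * gain (w i)) * inv_square_integral (\<lambda>t. 1 - cos t))"
    by (simp add: sum_ennreal[symmetric] sum_distrib_right del: sum_ennreal)
  also have "\<dots> \<le> (\<Sum>i\<in>I. ennreal (w i) * inv_square_integral (\<lambda>t. 1 - g i t))"
    by (rule sum_mono) (use g in blast)
  also have "\<dots> = (\<Sum>i\<in>I. inv_square_integral (\<lambda>t. w i * (1 - g i t)))"
    by (rule sum.cong[OF refl], subst inv_square_integral_cmult) (use w in \<open>auto simp: less_imp_le\<close>)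
  also have "\<dots> = inv_square_integral (\<lambda>t. \<Sum>i\<in>I. w i * (1 - g i t))"
    by (rule inv_square_integral_sum[symmetric]) (use w g in \<open>auto simp: less_imp_le\<close>)
  also have "\<dots> \<le> inv_square_integral (\<lambda>t. 1 - (\<Prod>i\<in>I. cos (a i * t)))"
  proof (rule inv_square_integral_mono)
    fix t
    have "(\<Prod>i\<in>I. cos (a i * t)) \<le> (\<Prod>i\<in>I. \<bar>cos (a i * t)\<bar>)"
      by (simp add: abs_prod[symmetric])
    also have "\<dots> \<le> (\<Prod>i\<in>I. g i t powr w i)"
      by (rule prod_mono) (use g in auto)
    also have "\<dots> \<le> (\<Sum>i\<in>I. w i * g i t)"
      by (rule weighted_arith_geom_mean) (use assms g in \<open>auto simp: less_imp_le\<close>)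
    finally show "(\<Sum>i\<in>I. w i * (1 - g i t)) \<le> 1 - (\<Prod>i\<in>I. cos (a i * t))"
      by (simp add: right_diff_distrib sum_subtractf sum)
  qed
  finally show ?thesis .
qed

section \<open>Random signs and the integral formula for \<open>R1\<close>\<close>

text \<open>The two atoms exhaust the mass. Letting g take values in a Banach space covers both real
  moments and the complex exponentials of characteristic functions.\<close>

lemma sym_bernoulli_expectation:
  fixes g :: "real \<Rightarrow> 'b::{banach, second_countable_topology}"
  assumes "prob_space M" and [measurable]: "X \<in> borel_measurable M"
    and "measure M {w \<in> space M. X w = 1} = 1 / 2"
    and "measure M {w \<in> space M. X w = -1} = 1 / 2"
  shows "AE w in M. X w = 1 \<or> X w = -1"
    and "g \<in> borel_measurable borel \<Longrightarrow> has_bochner_integral M (\<lambda>w. g (X w)) ((1/2) *\<^sub>R (g 1 + g (-1)))"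
proof -
  interpret prob_space M by fact
  let ?P = "{w \<in> space M. X w = 1}" and ?N = "{w \<in> space M. X w = -1}"
  have sets [measurable]: "?P \<in> sets M" "?N \<in> sets M" by measurable
  have "prob (?P \<union> ?N) = prob ?P + prob ?N"
    by (rule finite_measure_Union[OF sets]) auto
  then have "prob (?P \<union> ?N) = 1" using assms by simp
  then have "AE w in M. w \<in> ?P \<union> ?N"
    by (subst AE_in_set_eq_1) auto
  then show ae: "AE w in M. X w = 1 \<or> X w = -1"
    by eventually_elim auto
  assume [measurable]: "g \<in> borel_measurable borel"
  have "has_bochner_integral M (\<lambda>w. indicator ?P w *\<^sub>R g 1 + indicator ?N w *\<^sub>R g (-1))
      (measure M ?P *\<^sub>R g 1 + measure M ?N *\<^sub>R g (-1))"
    by (intro has_bochner_integral_add has_bochner_integral_indicator) (auto simp: less_top[symmetric])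
  then have "has_bochner_integral M (\<lambda>w. indicator ?P w *\<^sub>R g 1 + indicator ?N w *\<^sub>R g (-1))
      ((1/2) *\<^sub>R (g 1 + g (-1)))"
    using assms by (simp add: scaleR_add_right)
  then show "has_bochner_integral M (\<lambda>w. g (X w)) ((1/2) *\<^sub>R (g 1 + g (-1)))"
  proof (rule has_bochner_integral_cong_AE[THEN iffD1, rotated -1])
    show "AE w in M. indicator ?P w *\<^sub>R g 1 + indicator ?N w *\<^sub>R g (-1) = g (X w)"
      using ae AE_space by eventually_elim (auto simp: indicator_def)
  qed measurable
qed

lemma sym_bernoulliD:
  assumes "indep_sym_bernoulli M B"
  shows "prob_space M" "prob_space.indep_vars M (\<lambda>_. borel) B UNIV" "B i \<in> borel_measurable M"
    "measure M {w \<in> space M. B i w = 1} = 1 / 2" "measure M {w \<in> space M. B i w = -1} = 1 / 2"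
  using assms prob_space.indep_vars_def2[of M "\<lambda>_. borel" B UNIV]
  by (auto simp: indep_sym_bernoulli_def)

lemma bernoulli_AE:
  assumes "indep_sym_bernoulli M B"
  shows "AE w in M. B i w = 1 \<or> B i w = -1"
  by (rule sym_bernoulli_expectation(1)) (rule sym_bernoulliD[OF assms])+

lemma bernoulli_expectation:
  fixes g :: "real \<Rightarrow> 'b::{banach, second_countable_topology}"
  assumes "indep_sym_bernoulli M B" "g \<in> borel_measurable borel"
  shows "has_bochner_integral M (\<lambda>w. g (B i w)) ((1/2) *\<^sub>R (g 1 + g (-1)))"
  by (rule sym_bernoulli_expectation(2)) (rule sym_bernoulliD[OF assms(1)] assms(2))+

lemma integrable_bernoulli_sum:
  assumes "indep_sym_bernoulli M B"
  shows "integrable M (\<lambda>w. \<Sum>i\<in>UNIV. a $ i * B i w)"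
proof -
  have "integrable M (B i)" for i
    using bernoulli_expectation[OF assms, of "\<lambda>x. x" i] by (auto simp: has_bochner_integral_iff)
  then show ?thesis by (intro Bochner_Integration.integrable_sum integrable_mult_right)
qed

text \<open>By independence the characteristic function of the sum factorizes, and each sign
  contributes a real factor cos (\<open>a $ i\<close> t); the real part gives the claim.\<close>

lemma expectation_cos_bernoulli_sum:
  assumes B: "indep_sym_bernoulli M B"
  shows "(\<integral>w. cos (t * (\<Sum>i\<in>UNIV. a $ i * B i w)) \<partial>M) = (\<Prod>i\<in>UNIV. cos (a $ i * t))"
proof -
  interpret prob_space M by (rule sym_bernoulliD[OF B])
  note [measurable] = sym_bernoulliD(3)[OF B]
  let ?S = "\<lambda>w. \<Sum>i\<in>UNIV. a $ i * B i w"
  have "indep_vars (\<lambda>_. borel) (\<lambda>i w. a $ i * B i w) UNIV"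
    by (rule indep_vars_compose2[OF sym_bernoulliD(2)[OF B]]) measurable
  then have "char (distr M borel ?S) t = (\<Prod>i\<in>UNIV. char (distr M borel (\<lambda>w. a $ i * B i w)) t)"
    by (rule char_distr_sum)
  also have "\<dots> = (\<Prod>i\<in>UNIV. complex_of_real (cos (a $ i * t)))"
  proof (rule prod.cong[OF refl])
    fix i
    have "has_bochner_integral M (\<lambda>w. iexp (t * (a $ i * B i w)))
        ((1/2) *\<^sub>R (iexp (t * (a $ i * 1)) + iexp (t * (a $ i * (-1)))))"
      by (rule bernoulli_expectation[OF B, where g="\<lambda>x. iexp (t * (a $ i * x))"]) measurable
    also have "(1/2) *\<^sub>R (iexp (t * (a $ i * 1)) + iexp (t * (a $ i * (-1)))) = complex_of_real (cos (a $ i * t))"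
      by (simp add: complex_eq_iff Re_exp Im_exp mult.commute)
    finally show "char (distr M borel (\<lambda>w. a $ i * B i w)) t = complex_of_real (cos (a $ i * t))"
      by (simp add: char_def integral_distr has_bochner_integral_integral_eq)
  qed
  finally have "(CLINT w|M. iexp (t * ?S w)) = complex_of_real (\<Prod>i\<in>UNIV. cos (a $ i * t))"
    by (simp add: char_def integral_distr)
  then have "Re (CLINT w|M. iexp (t * ?S w)) = (\<Prod>i\<in>UNIV. cos (a $ i * t))"
    by (simp only: Re_complex_of_real)
  moreover have "integrable M (\<lambda>w. iexp (t * ?S w))"
    by (rule integrable_iexp) auto
  then have "(\<integral>w. Re (iexp (t * ?S w)) \<partial>M) = Re (CLINT w|M. iexp (t * ?S w))"
    by (rule integral_Re)
  moreover have "Re (iexp (t * x)) = cos (t * x)" for x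
    by (simp add: Re_exp)
  ultimately show ?thesis
    by (simp only:)
qed

text \<open>Under the expectation |S| is replaced by its integral over cosines; Tonelli exchanges
  the two integrals, and the expected cosine is the product.\<close>

lemma R1_inv_square_integral:
  assumes B: "indep_sym_bernoulli M B"
  shows "ennreal (R1 M B a) * inv_square_integral (\<lambda>t. 1 - cos t) = inv_square_integral (\<lambda>t. 1 - (\<Prod>i\<in>UNIV. cos (a $ i * t)))"
proof -
  interpret prob_space M by (rule sym_bernoulliD[OF B])
  interpret pair_sigma_finite lborel M ..
  note [measurable] = sym_bernoulliD(3)[OF B]
  define S where "S = (\<lambda>w. \<Sum>i\<in>UNIV. a $ i * B i w)"
  have [measurable]: "S \<in> borel_measurable M"
    unfolding S_def by measurable
  have "integrable M S"
    unfolding S_def by (rule integrable_bernoulli_sum[OF B])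
  then have "ennreal (R1 M B a) = (\<integral>\<^sup>+w. ennreal \<bar>S w\<bar> \<partial>M)"
    by (subst nn_integral_eq_integral) (auto simp: R1_def S_def)
  then have "ennreal (R1 M B a) * inv_square_integral (\<lambda>t. 1 - cos t) = (\<integral>\<^sup>+w. ennreal \<bar>S w\<bar> * inv_square_integral (\<lambda>t. 1 - cos t) \<partial>M)"
    by (simp add: nn_integral_multc)
  also have "\<dots> = (\<integral>\<^sup>+w. \<integral>\<^sup>+t. ennreal ((1 - cos (S w * t)) / t\<^sup>2) \<partial>lborel \<partial>M)"
    unfolding inv_square_integral_cos[symmetric] by (simp only: inv_square_integral_def)
  also have "\<dots> = (\<integral>\<^sup>+t. \<integral>\<^sup>+w. ennreal ((1 - cos (S w * t)) / t\<^sup>2) \<partial>M \<partial>lborel)"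
    by (rule Fubini') measurable
  also have "\<dots> = inv_square_integral (\<lambda>t. 1 - (\<Prod>i\<in>UNIV. cos (a $ i * t)))"
    unfolding inv_square_integral_def
  proof (rule nn_integral_cong)
    fix t :: real
    have int: "integrable M (\<lambda>w. cos (S w * t))"
      by (rule integrable_const_bound[where B=1]) auto
    then have "(\<integral>\<^sup>+w. ennreal ((1 - cos (S w * t)) / t\<^sup>2) \<partial>M) = ennreal (\<integral>w. (1 - cos (S w * t)) / t\<^sup>2 \<partial>M)"
      by (intro nn_integral_eq_integral) auto
    also have "(\<integral>w. (1 - cos (S w * t)) / t\<^sup>2 \<partial>M) = (1 - (\<integral>w. cos (S w * t) \<partial>M)) / t\<^sup>2"
      using int by (simp add: prob_space)
    also have "(\<integral>w. cos (S w * t) \<partial>M) = (\<Prod>i\<in>UNIV. cos (a $ i * t))"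
      using expectation_cos_bernoulli_sum[OF B, of t a] by (simp add: S_def mult.commute)
    finally show "(\<integral>\<^sup>+w. ennreal ((1 - cos (S w * t)) / t\<^sup>2) \<partial>M)
        = ennreal ((1 - (\<Prod>i\<in>UNIV. cos (a $ i * t))) / t\<^sup>2)" .
  qed
  finally show ?thesis .
qed

text \<open>The set I accommodates strictly positive weights: vanishing entries, whose natural
  weight is 0, are left out and only contribute factors cos 0 = 1.\<close>

lemma R1_ge_weighted:
  assumes B: "indep_sym_bernoulli M B"
    and zero: "\<And>i. i \<notin> I \<Longrightarrow> a $ i = 0"
    and w: "\<And>i. i \<in> I \<Longrightarrow> 0 < w i" "\<And>i. i \<in> I \<Longrightarrow> w i \<le> 1 / 2" "sum w I = 1"
  shows "(\<Sum>i\<in>I. \<bar>a $ i\<bar> * gain (w i)) \<le> R1 M B a"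
proof -
  have "(\<Prod>i\<in>UNIV. cos (a $ i * t)) = (\<Prod>i\<in>I. cos (a $ i * t))" for t
    by (rule prod.mono_neutral_right) (auto simp: zero)
  then have "ennreal (\<Sum>i\<in>I. \<bar>a $ i\<bar> * gain (w i)) * inv_square_integral (\<lambda>t. 1 - cos t)
      \<le> ennreal (R1 M B a) * inv_square_integral (\<lambda>t. 1 - cos t)"
    using inv_square_integral_prod_cos_ge[OF _ w, of "\<lambda>i. a $ i"] by (simp add: R1_inv_square_integral[OF B])
  then have "ennreal (\<Sum>i\<in>I. \<bar>a $ i\<bar> * gain (w i)) \<le> ennreal (R1 M B a)"
    using ennreal_mult_le_mult_iff[of "inv_square_integral (\<lambda>t. 1 - cos t)"] inv_square_integral_cos_pos inv_square_integral_cos_finite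
    by (simp only: mult.commute[of _ "inv_square_integral _"]) (auto simp: less_top)
  moreover have "0 \<le> R1 M B a"
    by (simp add: R1_def)
  ultimately show ?thesis by simp
qed

text \<open>The signs are orthonormal, so \<open>a $ i\<close> is the expectation of S times
  \<open>B i\<close>, and multiplying by \<open>B i\<close> leaves |S| unchanged almost
  everywhere.\<close>

lemma abs_component_le_R1:
  assumes B: "indep_sym_bernoulli M B"
  shows "\<bar>a $ i\<bar> \<le> R1 M B a"
proof -
  interpret prob_space M by (rule sym_bernoulliD[OF B])
  note [measurable] = sym_bernoulliD(3)[OF B]
  have B_int: "integrable M (B j)" "expectation (B j) = 0" for j
    using bernoulli_expectation[OF B, of "\<lambda>x. x" j] by (auto simp: has_bochner_integral_iff)
  have "has_bochner_integral M (\<lambda>w. B j w * B i w) (if j = i then 1 else 0)" for j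
  proof (cases "j = i")
    case True
    then show ?thesis
      using bernoulli_expectation[OF B, of "\<lambda>x. x * x" i] by simp
  next
    case False
    have "indep_vars (\<lambda>_. borel) B {j, i}"
      by (rule indep_vars_subset[OF sym_bernoulliD(2)[OF B]]) auto
    with indep_vars_lebesgue_integral[of "{j, i}" B] indep_vars_integrable[of "{j, i}" B] False B_int
    show ?thesis by (auto simp: has_bochner_integral_iff)
  qed
  then have "has_bochner_integral M (\<lambda>w. \<Sum>j\<in>UNIV. a $ j * (B j w * B i w)) (\<Sum>j\<in>UNIV. a $ j * (if j = i then 1 else 0))"
    by (intro has_bochner_integral_sum has_bochner_integral_mult_right)
  then have hb: "has_bochner_integral M (\<lambda>w. (\<Sum>j\<in>UNIV. a $ j * B j w) * B i w) (a $ i)"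
    by (simp add: sum_distrib_right mult.assoc if_distrib cong: if_cong)
  have "\<bar>a $ i\<bar> = \<bar>\<integral>w. (\<Sum>j\<in>UNIV. a $ j * B j w) * B i w \<partial>M\<bar>"
    using has_bochner_integral_integral_eq[OF hb] by simp
  also have "\<dots> \<le> (\<integral>w. \<bar>(\<Sum>j\<in>UNIV. a $ j * B j w) * B i w\<bar> \<partial>M)"
    by (rule integral_abs_bound)
  also have "\<dots> = R1 M B a"
    unfolding R1_def
  proof (rule integral_cong_AE)
    show "AE w in M. \<bar>(\<Sum>j\<in>UNIV. a $ j * B j w) * B i w\<bar> = \<bar>\<Sum>j\<in>UNIV. a $ j * B j w\<bar>"
      using bernoulli_AE[OF B, of i] by eventually_elim (auto simp: abs_mult)
  qed measurable
  finally show ?thesis .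
qed

section \<open>Numerical inequalities\<close>

text \<open>The first branch reduces to 3/4 \<ge> 1 / sqrt 2. The affine branch is the tangent at w
  = 1/2 to the concave function sqrt (w / 2).\<close>

lemma gain_ge:
  assumes "0 \<le> w"
  shows "sqrt w / sqrt 2 \<le> gain w"
proof (cases "w \<le> 1 / 4")
  case True
  have "sqrt (16 / 9) \<le> sqrt 2" by (simp only: real_sqrt_le_iff)
  then have "4 / 3 \<le> sqrt 2" by (simp add: real_sqrt_divide)
  then have "1 / sqrt 2 \<le> 3 / 4" by (simp add: field_simps)
  from mult_right_mono[OF this, of "sqrt w"] show ?thesis
    using assms True by (simp add: gain_def)
next
  case False
  have "0 \<le> (sqrt w / sqrt 2 - 1 / 2)\<^sup>2" by simp
  also have "\<dots> = w / 2 + 1 / 4 - sqrt w / sqrt 2"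
    using assms by (simp add: power2_diff power_divide)
  finally show ?thesis using False by (simp add: gain_def)
qed

text \<open>The lower bound is affine in b^2, so it can be summed using |a| = 1. It is the tangent
  at b^2 = 1/4 to the affine-branch expression; the difference is a cubic in |b| with the double
  root 1/2.\<close>

lemma gain_square_ge:
  assumes "1 / 4 < b\<^sup>2"
  shows "3 / 4 * b\<^sup>2 - (b\<^sup>2 - 1 / 4) / 8 \<le> \<bar>b\<bar> * gain (b\<^sup>2)"
proof -
  have "(1 / 2)\<^sup>2 < \<bar>b\<bar>\<^sup>2"
    using assms by (simp add: power2_eq_square)
  then have "1 / 2 < \<bar>b\<bar>"
    by (rule power2_less_imp_less) simp
  then have "0 \<le> (\<bar>b\<bar> - 1 / 2)\<^sup>2 * (\<bar>b\<bar> - 1 / 4) / 2"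
    by simp
  also have "\<dots> = \<bar>b\<bar> * (\<bar>b\<bar>\<^sup>2 / 2 + 1 / 4) - (3 / 4 * \<bar>b\<bar>\<^sup>2 - (\<bar>b\<bar>\<^sup>2 - 1 / 4) / 8)"
    by (simp add: field_simps power2_eq_square)
  finally show ?thesis using assms by (simp add: gain_def)
qed

lemma sqrt_2_bounds: "707 / 500 \<le> sqrt 2" "sqrt 2 \<le> 283 / 200"
  by (rule real_le_rsqrt real_le_lsqrt; simp add: power2_eq_square)+

text \<open>In the next two lemmas $r$ stands for the sum of squares outside the two largest entries; $A$
  is the largest entry in absolute value, $B$ the square of the second and $l$ normalizes the weights.\<close>
lemma rest_le_of_le_half:
  fixes r \<epsilon> :: real
  assumes "(1 - r) / sqrt 2 + 3 / 4 * r \<le> (1 + \<epsilon>) / sqrt 2" "0 \<le> r"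
  shows "r \<le> 17 * \<epsilon>"
proof -
  have "(1 - r) + 3 / 4 * sqrt 2 * r \<le> 1 + \<epsilon>"
    using mult_right_mono[OF assms(1), of "sqrt 2"]
    by (simp only: distrib_right nonzero_divide_eq_eq mult.assoc mult.commute[of r]) simp
  \<comment> \<open>This makes the coefficient of r at least 3/4 * 1.414 - 1 = 0.0605, which exceeds
    1/17.\<close>
  moreover have "707 / 500 * r \<le> sqrt 2 * r"
    using sqrt_2_bounds assms(2) by (intro mult_right_mono)
  ultimately show ?thesis using assms(2) by simp
qed

lemma rest_le_of_half_le:
  fixes A B r \<epsilon> l :: real
  assumes \<epsilon>: "0 < \<epsilon>" "\<epsilon> < 1 / 100" and r: "0 \<le> r"
    and A: "1 / sqrt 2 \<le> A" "A \<le> (1 + \<epsilon>) / sqrt 2"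
    and l: "0 < l" "l\<^sup>2 = 2 * (1 - A\<^sup>2)" "B + r = l\<^sup>2 / 2"
    and le: "A / 2 + B / l / sqrt 2 + 3 / 4 * r / l \<le> (1 + \<epsilon>) / sqrt 2"
  shows "r \<le> 17 * \<epsilon>"
proof -
  \<comment> \<open>Relative excess of the largest entry: A = (1 + \<eta>) / sqrt 2.\<close>
  define \<eta> where "\<eta> = A * sqrt 2 - 1"
  have \<eta>: "0 \<le> \<eta>" "\<eta> \<le> \<epsilon>"
    using A by (auto simp: \<eta>_def field_simps)
  have l_eq: "l\<^sup>2 = 2 - (1 + \<eta>)\<^sup>2"
    unfolding l(2) by (simp add: \<eta>_def power_mult_distrib)
  have "\<eta> ^ 2 \<le> \<epsilon> * \<epsilon>"
    unfolding power2_eq_square using \<eta> by (intro mult_mono) auto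
  also have "\<dots> \<le> (1 / 100) * \<epsilon>"
    using \<epsilon> by (intro mult_right_mono) auto
  finally have \<eta>2: "\<eta>\<^sup>2 \<le> \<epsilon> / 100" by simp
  \<comment> \<open>A polynomial lower bound for l = sqrt (2 - (1 + \<eta>)^2). Its linear term
    cancels that of A in (1 + \<eta>) / 2 + l / 2, so the excess \<eta> costs only \<eta>^2.\<close>
  have "(1 - \<eta> - 2 * \<eta>\<^sup>2)\<^sup>2 = (2 - (1 + \<eta>)\<^sup>2) - 2 * \<eta>\<^sup>2 * (1 - 2 * \<eta> - 2 * \<eta>\<^sup>2)"
    by (simp add: power2_eq_square algebra_simps)
  also have "\<dots> \<le> l\<^sup>2"
    using \<eta> \<eta>2 \<epsilon> l_eq by simp
  finally have l_ge: "1 - \<eta> - 2 * \<eta>\<^sup>2 \<le> l"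
    using l(1) by (rule power2_le_imp_le[OF _ less_imp_le])
  have "l\<^sup>2 = 1 - (2 * \<eta> + \<eta>\<^sup>2)"
    unfolding l_eq by (simp add: power2_eq_square algebra_simps)
  moreover have "0 \<le> 2 * \<eta> + \<eta>\<^sup>2"
    using \<eta>(1) by simp
  ultimately have "l\<^sup>2 \<le> 1\<^sup>2"
    by simp
  then have "l \<le> 1" by (rule power2_le_imp_le) simp
  define q where "q = r / l"
  have "B / l = l / 2 - q"
    using l(1,3) by (simp add: q_def field_simps power2_eq_square)
  with le have "A / 2 + (l / 2 - q) / sqrt 2 + 3 / 4 * q \<le> (1 + \<epsilon>) / sqrt 2"
    by (simp add: q_def)
  then have "(A / 2 + (l / 2 - q) / sqrt 2 + 3 / 4 * q) * sqrt 2 \<le> 1 + \<epsilon>"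
    by (subst (asm) pos_le_divide_eq) simp_all
  also have "(A / 2 + (l / 2 - q) / sqrt 2 + 3 / 4 * q) * sqrt 2
      = (1 + \<eta>) / 2 + l / 2 + (3 / 4 * sqrt 2 - 1) * q"
    unfolding \<eta>_def distrib_right left_diff_distrib[of _ _ q] by simp
  finally have "(1 + \<eta>) / 2 + l / 2 + (3 / 4 * sqrt 2 - 1) * q \<le> 1 + \<epsilon>" .
  \<comment> \<open>Here 3/50 is below 0.0605 = 3/4 * 1.414 - 1, and r \<le> r / l because l \<le>
    1.\<close>
  moreover have "3 / 50 * r \<le> (3 / 4 * sqrt 2 - 1) * q"
    unfolding q_def using sqrt_2_bounds r l(1) \<open>l \<le> 1\<close> by (intro mult_mono) (auto simp: pos_le_divide_eq intro: mult_right_le_one_le)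
  ultimately have "(1 + \<eta>) / 2 + l / 2 + 3 / 50 * r \<le> 1 + \<epsilon>"
    by linarith
  then have "3 / 50 * r \<le> \<epsilon> + \<eta>\<^sup>2"
    using l_ge by (simp add: field_simps)
  then show ?thesis using \<eta>2 \<epsilon> by simp
qed

text \<open>The hypotheses give B^2 \<ge> 1/2 - 18 \<epsilon> - \<epsilon>^2 / 2, while the square
  of the claimed bound is 1/2 - 30 \<epsilon> + 450 \<epsilon>^2. The spare 12 \<epsilon> absorbs
  the quadratic terms because \<epsilon> < 1/100.\<close>

lemma second_largest_ge:
  fixes A B r \<epsilon> :: real
  assumes \<epsilon>: "0 < \<epsilon>" "\<epsilon> < 1 / 100" and r: "r \<le> 17 * \<epsilon>"
    and A: "0 \<le> A" "A \<le> (1 + \<epsilon>) / sqrt 2" and "0 \<le> B" and sum: "A\<^sup>2 + B\<^sup>2 + r = 1"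
  shows "(1 - 30 * \<epsilon>) / sqrt 2 \<le> B"
proof (rule power2_le_imp_le)
  have "A\<^sup>2 \<le> ((1 + \<epsilon>) / sqrt 2)\<^sup>2"
    using A by (intro power_mono)
  also have "\<dots> = (1 + 2 * \<epsilon> + \<epsilon>\<^sup>2) / 2"
    by (simp add: power_divide power2_eq_square algebra_simps)
  finally have "1 - 17 * \<epsilon> - (1 + 2 * \<epsilon> + \<epsilon>\<^sup>2) / 2 \<le> B\<^sup>2"
    using r sum by linarith
  moreover have "\<epsilon>\<^sup>2 \<le> \<epsilon> / 100"
    using \<epsilon> by (simp add: power2_eq_square)
  ultimately have "(1 - 60 * \<epsilon> + 900 * (\<epsilon>\<^sup>2)) / 2 \<le> B\<^sup>2"
    using \<epsilon> by (simp add: field_simps)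
  also have "(1 - 60 * \<epsilon> + 900 * (\<epsilon>\<^sup>2)) / 2 = ((1 - 30 * \<epsilon>) / sqrt 2)\<^sup>2"
    by (simp add: power_divide power2_eq_square algebra_simps)
  finally show "((1 - 30 * \<epsilon>) / sqrt 2)\<^sup>2 \<le> B\<^sup>2" .
qed fact

section \<open>The mass outside the two largest entries\<close>

text \<open>Weights above 1/2 are not admissible, hence the case split: the squares themselves serve
  as weights unless the largest exceeds 1/2, in which case its weight is capped at 1/2 and the
  others are rescaled.\<close>

lemma rest_le:
  fixes a :: "real ^ 'n"
  assumes B: "indep_sym_bernoulli M B"
    and \<epsilon>: "0 < \<epsilon>" "\<epsilon> < 1 / 100"
    and R: "R1 M B a \<le> (1 + \<epsilon>) / sqrt 2"
    and one: "(\<Sum>i\<in>UNIV. (a $ i)\<^sup>2) = 1"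
    and "i1 \<noteq> i2"
    and max1: "\<And>i. \<bar>a $ i\<bar> \<le> \<bar>a $ i1\<bar>"
    and max2: "\<And>i. i \<noteq> i1 \<Longrightarrow> \<bar>a $ i\<bar> \<le> \<bar>a $ i2\<bar>"
  shows "(\<Sum>i\<in>UNIV - {i1, i2}. (a $ i)\<^sup>2) \<le> 17 * \<epsilon>"
proof -
  let ?J = "UNIV - {i1, i2}"
  let ?I = "{i. a $ i \<noteq> 0}"
  define r where "r = (\<Sum>i\<in>?J. (a $ i)\<^sup>2)"
  have split: "(\<Sum>i\<in>UNIV. f i) = f i1 + f i2 + (\<Sum>i\<in>?J. f i)" for f :: "'n \<Rightarrow> real"
  proof -
    have "(\<Sum>i\<in>UNIV. f i) = (\<Sum>i\<in>{i1, i2}. f i) + (\<Sum>i\<in>?J. f i)"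
      using sum.subset_diff[of "{i1, i2}" UNIV f] by simp
    then show ?thesis using \<open>i1 \<noteq> i2\<close> by simp
  qed
  have "0 \<le> r" by (simp add: r_def sum_nonneg)
  have sum: "(a $ i1)\<^sup>2 + (a $ i2)\<^sup>2 + r = 1"
    using one unfolding split r_def .
  have sq1: "(a $ i)\<^sup>2 \<le> (a $ i1)\<^sup>2" for i
    using max1 by (simp add: abs_le_square_iff)
  have sq2: "(a $ i)\<^sup>2 \<le> (a $ i2)\<^sup>2" if "i \<noteq> i1" for i
    using max2[OF that] by (simp add: abs_le_square_iff)
  have "r \<le> 17 * \<epsilon>"
  proof (cases "(a $ i1)\<^sup>2 \<le> 1 / 2")
    case True
    let ?t = "\<lambda>i. \<bar>a $ i\<bar> * gain ((a $ i)\<^sup>2)"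
    have "(\<Sum>i\<in>?I. (a $ i)\<^sup>2) = (\<Sum>i\<in>UNIV. (a $ i)\<^sup>2)"
      by (rule sum.mono_neutral_left) auto
    then have "(\<Sum>i\<in>?I. ?t i) \<le> R1 M B a"
      using order_trans[OF sq1 True] one by (intro R1_ge_weighted[OF B]) simp_all
    also have "(\<Sum>i\<in>?I. ?t i) = (\<Sum>i\<in>UNIV. ?t i)"
      by (rule sum.mono_neutral_left) auto
    finally have ge: "(\<Sum>i\<in>UNIV. ?t i) \<le> (1 + \<epsilon>) / sqrt 2"
      using R by simp
    have small: "?t i = 3 / 4 * (a $ i)\<^sup>2" if "(a $ i)\<^sup>2 \<le> 1 / 4" for i
      using that by (simp add: gain_def power2_eq_square)
    show ?thesis
    proof (cases "\<exists>i3\<in>?J. 1 / 4 < (a $ i3)\<^sup>2")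
      case True
      then obtain i3 where i3: "i3 \<noteq> i1" "i3 \<noteq> i2" "1 / 4 < (a $ i3)\<^sup>2" by auto
      let ?P = "{i. 1 / 4 < (a $ i)\<^sup>2}"
      have "card {i1, i2, i3} \<le> card ?P"
        using i3 sq1[of i3] sq2[of i3] by (intro card_mono) auto
      then have card: "3 \<le> real (card ?P)"
        using i3 \<open>i1 \<noteq> i2\<close> by auto
      have "(\<Sum>i\<in>?P. (a $ i)\<^sup>2) \<le> 1"
        unfolding one[symmetric] by (rule sum_mono2) auto
      \<comment> \<open>At least three indices lie in \<open>?P\<close>, so the excesses over 1/4
        add up to at most 1 - 3/4 = 1/4, and an eighth of that is 1/32.\<close>
      with card have "(\<Sum>i\<in>?P. ((a $ i)\<^sup>2 - 1 / 4) / 8) \<le> 1 / 32"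
        by (simp add: sum_divide_distrib[symmetric] sum_subtractf)
      moreover have "(\<Sum>i\<in>UNIV. 3 / 4 * (a $ i)\<^sup>2 - (if i \<in> ?P then ((a $ i)\<^sup>2 - 1 / 4) / 8 else 0))
          \<le> (\<Sum>i\<in>UNIV. ?t i)"
        using gain_square_ge small by (intro sum_mono) (auto simp: not_less)
      moreover have "(\<Sum>i\<in>UNIV. 3 / 4 * (a $ i)\<^sup>2 - (if i \<in> ?P then ((a $ i)\<^sup>2 - 1 / 4) / 8 else 0))
          = 3 / 4 - (\<Sum>i\<in>?P. ((a $ i)\<^sup>2 - 1 / 4) / 8)"
        by (simp only: sum_subtractf sum_distrib_left[symmetric] one) (simp add: sum.If_cases)
      ultimately have "23 / 32 \<le> (1 + \<epsilon>) / sqrt 2"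
        using ge by linarith
      then have "23 / 32 * sqrt 2 \<le> 1 + \<epsilon>"
        by (simp add: field_simps)
      \<comment> \<open>The left side is at least 1.016, the right side below 1.01.\<close>
      then have False using sqrt_2_bounds \<epsilon> by linarith
      then show ?thesis ..
    next
      case False
      have large: "(a $ i)\<^sup>2 / sqrt 2 \<le> ?t i" for i
        using mult_left_mono[OF gain_ge[of "(a $ i)\<^sup>2"], of "\<bar>a $ i\<bar>"] by (simp add: power2_eq_square)
      have "(\<Sum>i\<in>?J. ?t i) = 3 / 4 * r"
        unfolding r_def sum_distrib_left by (rule sum.cong) (use small False in \<open>auto simp: not_less\<close>)
      then have "(a $ i1)\<^sup>2 / sqrt 2 + (a $ i2)\<^sup>2 / sqrt 2 + 3 / 4 * r \<le> (1 + \<epsilon>) / sqrt 2"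
        using ge[unfolded split] large[of i1] large[of i2] by linarith
      moreover have "(a $ i1)\<^sup>2 / sqrt 2 + (a $ i2)\<^sup>2 / sqrt 2 = (1 - r) / sqrt 2"
        using sum by (simp add: add_divide_distrib[symmetric] eq_diff_eq)
      ultimately show ?thesis
        using \<open>0 \<le> r\<close> by (intro rest_le_of_le_half) simp_all
    qed
  next
    case False
    define A where "A = \<bar>a $ i1\<bar>"
    have A2: "A\<^sup>2 = (a $ i1)\<^sup>2" by (simp add: A_def)
    have "(1 / sqrt 2)\<^sup>2 \<le> A\<^sup>2"
      using False by (simp add: A2 power_divide)
    then have A_ge: "1 / sqrt 2 \<le> A"
      by (rule power2_le_imp_le) (simp add: A_def)
    have A_le: "A \<le> (1 + \<epsilon>) / sqrt 2"
      using abs_component_le_R1[OF B, of a i1] R by (simp add: A_def)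
    have "A\<^sup>2 \<le> ((1 + \<epsilon>) / sqrt 2)\<^sup>2"
      using A_le by (intro power_mono) (auto simp: A_def)
    also have "\<dots> = (1 + 2 * \<epsilon> + \<epsilon>\<^sup>2) / 2"
      by (simp add: power_divide power2_eq_square algebra_simps)
    also have "\<dots> < 1"
    proof -
      have "\<epsilon>\<^sup>2 \<le> \<epsilon>"
        using \<epsilon> by (simp add: power2_eq_square)
      then show ?thesis using \<epsilon> by simp
    qed
    finally have "A\<^sup>2 < 1" .
    \<comment> \<open>Division by l^2 turns the remaining squares, of total 1 - A^2, into weights of
      total 1/2, which complement the capped weight 1/2.\<close>
    define l where "l = sqrt (2 * (1 - A\<^sup>2))"
    have l: "0 < l" "l\<^sup>2 = 2 * (1 - A\<^sup>2)"
      using \<open>A\<^sup>2 < 1\<close> by (auto simp: l_def)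
    have l_sum: "(a $ i2)\<^sup>2 + r = l\<^sup>2 / 2"
      using sum by (simp add: l A2)
    define w where "w = (\<lambda>i. if i = i1 then 1 / 2 else (a $ i)\<^sup>2 / l\<^sup>2)"
    let ?t = "\<lambda>i. \<bar>a $ i\<bar> * gain (w i)"
    have sqrt_w: "sqrt (w i) = \<bar>a $ i\<bar> / l" if "i \<noteq> i1" for i
      using l(1) that by (simp add: w_def real_sqrt_divide)
    have "(\<Sum>i\<in>?I. w i) = (\<Sum>i\<in>UNIV. w i)"
      using False by (intro sum.mono_neutral_left) (auto simp: w_def)
    also have "\<dots> = 1 / 2 + (a $ i2)\<^sup>2 / l\<^sup>2 + r / l\<^sup>2"
      unfolding split r_def sum_divide_distrib using \<open>i1 \<noteq> i2\<close> by (simp add: w_def)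
    also have "\<dots> = 1 / 2 + (l\<^sup>2 / 2) / l\<^sup>2"
      by (simp only: l_sum[symmetric] add.assoc add_divide_distrib)
    also have "\<dots> = 1"
      using l(1) by simp
    finally have w_sum: "(\<Sum>i\<in>?I. w i) = 1" .
    have "w i \<le> 1 / 2" for i
    proof (cases "i = i1")
      case False
      then have "(a $ i)\<^sup>2 \<le> l\<^sup>2 / 2"
        using sq2[of i] l_sum \<open>0 \<le> r\<close> by simp
      then show ?thesis using False l(1) by (simp add: w_def field_simps)
    qed (simp add: w_def)
    then have "(\<Sum>i\<in>?I. ?t i) \<le> R1 M B a"
      using w_sum l(1) by (intro R1_ge_weighted[OF B]) (auto simp: w_def)
    also have "(\<Sum>i\<in>?I. ?t i) = (\<Sum>i\<in>UNIV. ?t i)"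
      by (rule sum.mono_neutral_left) auto
    finally have ge: "(\<Sum>i\<in>UNIV. ?t i) \<le> (1 + \<epsilon>) / sqrt 2"
      using R by simp
    have t1: "?t i1 = A / 2"
      by (simp add: w_def gain_def A_def)
    have "\<bar>a $ i2\<bar> * (sqrt (w i2) / sqrt 2) \<le> ?t i2"
      using l(1) by (intro mult_left_mono gain_ge) (auto simp: w_def)
    then have t2: "(a $ i2)\<^sup>2 / l / sqrt 2 \<le> ?t i2"
      using sqrt_w[of i2] \<open>i1 \<noteq> i2\<close> by (simp add: power2_eq_square)
    have "?t i = 3 / 4 * (a $ i)\<^sup>2 / l" if "i \<in> ?J" for i
    proof -
      \<comment> \<open>The square is bounded both by r and by the square of entry
        \<open>i2\<close>, and these two add up to l^2 / 2. So its weight is at most 1/4 and no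
        further case split arises.\<close>
      have "(a $ i)\<^sup>2 \<le> r"
        unfolding r_def using that by (intro member_le_sum) auto
      then have "(a $ i)\<^sup>2 \<le> l\<^sup>2 / 4"
        using sq2[of i] that l_sum by simp
      then have "w i \<le> 1 / 4"
        using that l(1) by (simp add: w_def field_simps)
      then show ?thesis
        using sqrt_w[of i] that by (simp add: gain_def power2_eq_square)
    qed
    then have "(\<Sum>i\<in>?J. ?t i) = 3 / 4 * r / l"
      by (simp add: r_def sum_distrib_left sum_divide_distrib)
    with ge[unfolded split] t1 t2
    have "A / 2 + (a $ i2)\<^sup>2 / l / sqrt 2 + 3 / 4 * r / l \<le> (1 + \<epsilon>) / sqrt 2"
      by linarith
    then show ?thesis
      by (rule rest_le_of_half_le[OF \<epsilon> \<open>0 \<le> r\<close> A_ge A_le l l_sum])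
  qed
  then show ?thesis by (simp only: r_def)
qed

theorem theorem4:
  fixes M :: "'w measure" and B :: "'n::finite \<Rightarrow> 'w \<Rightarrow> real"
    and a :: "real ^ 'n" and \<epsilon> :: real
  assumes "indep_sym_bernoulli M B"
    and "0 < \<epsilon>" and "\<epsilon> < 1 / 100"
    and "norm a = 1"
    and "R1 M B a \<le> (1 + \<epsilon>) / sqrt 2"
  shows "\<exists>i1 i2. i1 \<noteq> i2 \<and>
           (1 - 30 * \<epsilon>) / sqrt 2 \<le> \<bar>a $ i1\<bar> \<and> \<bar>a $ i1\<bar> \<le> (1 + \<epsilon>) / sqrt 2 \<and>
           (1 - 30 * \<epsilon>) / sqrt 2 \<le> \<bar>a $ i2\<bar> \<and> \<bar>a $ i2\<bar> \<le> (1 + \<epsilon>) / sqrt 2 \<and>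
           (\<Sum>i\<in>UNIV - {i1, i2}. (a $ i)\<^sup>2) \<le> 57 * \<epsilon> \<and>
           (\<forall>i. i \<noteq> i1 \<and> i \<noteq> i2 \<longrightarrow> \<bar>a $ i\<bar> \<le> sqrt (57 * \<epsilon>))"
proof -
  note B = assms(1) and \<epsilon> = assms(2,3) and R = assms(5)
  have one: "(\<Sum>i\<in>UNIV. (a $ i)\<^sup>2) = 1"
    using \<open>norm a = 1\<close> by (simp add: norm_vec_def L2_set_def)
  have upper: "\<bar>a $ i\<bar> \<le> (1 + \<epsilon>) / sqrt 2" for i
    using abs_component_le_R1[OF B, of a i] R by simp
  have max_ex: "\<exists>i\<in>I. \<forall>j\<in>I. \<bar>a $ j\<bar> \<le> \<bar>a $ i\<bar>" if "I \<noteq> {}" for I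
  proof -
    have "Max ((\<lambda>i. \<bar>a $ i\<bar>) ` I) \<in> (\<lambda>i. \<bar>a $ i\<bar>) ` I"
      using that by (intro Max_in) auto
    then obtain i where "i \<in> I" "\<bar>a $ i\<bar> = Max ((\<lambda>i. \<bar>a $ i\<bar>) ` I)" by auto
    then show ?thesis by (intro bexI[of _ i]) auto
  qed
  from max_ex[of UNIV] obtain i1 where i1: "\<And>i. \<bar>a $ i\<bar> \<le> \<bar>a $ i1\<bar>" by auto
  \<comment> \<open>In dimension one the only entry would be 1 or -1, beyond the upper bound (1 +
    \<epsilon>) / sqrt 2.\<close>
  have "UNIV - {i1} \<noteq> {}"
  proof
    assume "UNIV - {i1} = {}"
    then have "(\<Sum>i\<in>UNIV. (a $ i)\<^sup>2) = (\<Sum>i\<in>{i1}. (a $ i)\<^sup>2)"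
      by (intro sum.cong) auto
    with one have "(a $ i1)\<^sup>2 = 1" by simp
    then have "\<bar>a $ i1\<bar> = 1" by (simp only: abs_square_eq_1)
    with upper[of i1] have "sqrt 2 \<le> 1 + \<epsilon>" by (simp add: field_simps)
    then show False using \<epsilon> sqrt_2_bounds by simp
  qed
  from max_ex[OF this] obtain i2 where "i2 \<noteq> i1" and i2: "\<And>i. i \<noteq> i1 \<Longrightarrow> \<bar>a $ i\<bar> \<le> \<bar>a $ i2\<bar>"
    by auto
  let ?r = "\<Sum>i\<in>UNIV - {i1, i2}. (a $ i)\<^sup>2"
  \<comment> \<open>The lower bound with the constant 30 is derived from 17; the weaker 57 enters
    only in the final statements on the remaining entries.\<close>
  have r: "?r \<le> 17 * \<epsilon>"
    using rest_le[OF B \<epsilon> R one \<open>i2 \<noteq> i1\<close>[symmetric] i1 i2] .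
  have "(\<Sum>i\<in>{i1, i2}. (a $ i)\<^sup>2) + ?r = 1"
    using sum.subset_diff[of "{i1, i2}" UNIV "\<lambda>i. (a $ i)\<^sup>2"] one by simp
  then have "\<bar>a $ i1\<bar>\<^sup>2 + \<bar>a $ i2\<bar>\<^sup>2 + ?r = 1"
    using \<open>i2 \<noteq> i1\<close> by simp
  then have lower: "(1 - 30 * \<epsilon>) / sqrt 2 \<le> \<bar>a $ i2\<bar>"
    by (rule second_largest_ge[OF \<epsilon> r abs_ge_zero upper abs_ge_zero])
  have "\<bar>a $ i\<bar> \<le> sqrt (57 * \<epsilon>)" if "i \<noteq> i1" "i \<noteq> i2" for i
  proof -
    have "(a $ i)\<^sup>2 \<le> ?r"
      using that by (intro member_le_sum) auto
    then show ?thesis using r \<epsilon> by (intro real_le_rsqrt) simp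
  qed
  then have small: "\<forall>i. i \<noteq> i1 \<and> i \<noteq> i2 \<longrightarrow> \<bar>a $ i\<bar> \<le> sqrt (57 * \<epsilon>)"
    by blast
  have rest: "?r \<le> 57 * \<epsilon>"
    using r \<epsilon> by simp
  show ?thesis
    by (rule exI[of _ i1], rule exI[of _ i2], intro conjI)
       (fact \<open>i2 \<noteq> i1\<close>[symmetric] order_trans[OF lower i1] upper lower rest small)+
qed

end
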